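(* The maps $\tau\colon\Lambda(\mathsf{MIPC})\to\Lambda(\mathsf{MS4})$, $\tau\mathsf L=\mathsf{MS4}+\{\varphi^t:\mathsf L\vdash\varphi\}$, and $\sigma\colon\Lambda(\mathsf{MIPC})\to\Lambda(\mathsf{MGrz})$, $\sigma\mathsf L=\mathsf{MGrz}+\{\varphi^t:\mathsf L\vdash\varphi\}$, are lattice homomorphisms.
   Context: $\mathcal L_{\forall\exists}$ is the propositional language with connectives $\bot,\wedge,\vee,\to$ (and $\neg\varphi=\varphi\to\bot$) and two unary modalities $\forall,\exists$. $\mathsf{MIPC}$ is the smallest set of $\mathcal L_{\forall\exists}$-formulas containing all theorems of the intuitionistic propositional calculus and the formulas $\forall(p\land q)\leftrightarrow(\forall p\land\forall q)$, $\forall p\to p$, $\forall p\to\forall\forall p$, $\exists(p\vee q)\leftrightarrow(\exists p\vee\exists q)$, $p\to\exists p$, $\exists\exists p\to\exists p$, $(\exists p\land\exists q)\to\exists(\exists p\land q)$, $\exists\forall p\leftrightarrow\forall p$, $\exists p\leftrightarrow\forall\exists p$, and closed under modus ponens, substitution, and necessitation $\varphi/\forall\varphi$. An extension of $\mathsf{MIPC}$ is a set of $\mathcal L_{\forall\exists}$-formulas containing $\mathsf{MIPC}$ and closed under the same rules. $\Lambda(\mathsf{MIPC})$ is the complete lattice of extensions of $\mathsf{MIPC}$ ordered by inclusion (meets are intersections; the join is the least extension containing the union). $\mathcal L_{\Box\forall}$ is the classical propositional modal language with two unary modalities $\Box,\forall$; $\exists$ abbreviates $\neg\forall\neg$. $\mathsf{MS4}$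 is the smallest set of $\mathcal L_{\Box\forall}$-formulas containing all theorems of classical propositional calculus, the $\mathsf{S4}$-axioms for $\Box$, the $\mathsf{S5}$-axioms for $\forall$, the axiom $\Box\forall p\to\forall\Box p$, and closed under modus ponens, substitution, $\Box$-necessitation and $\forall$-necessitation. Extensions of $\mathsf{MS4}$ are sets of $\mathcal L_{\Box\forall}$-formulas containing $\mathsf{MS4}$ and closed under these rules; $\mathsf M+\Gamma$ is the least extension containing $\mathsf M\cup\Gamma$. $\mathsf{MGrz}=\mathsf{MS4}+\{\Box(\Box(p\to\Box p)\to p)\to p\}$. $\Lambda(\mathsf{MS4})$ and $\Lambda(\mathsf{MGrz})$ are the complete lattices (under inclusion) of all extensions of $\mathsf{MS4}$, respectively of those containing $\mathsf{MGrz}$. $\mathsf L\vdash\varphi$ means $\varphi\in\mathsf L$. The Gödel translation $(-)^t$ from $\mathcal L_{\forall\exists}$-formulas to $\mathcal L_{\Box\forall}$-formulas: $\bot^t=\bot$, $p^t=\Box p$ for propositional letters $p$, $(\varphi\land\psi)^t=\varphi^t\land\psi^t$, $(\varphi\lor\psi)^t=\varphi^t\lor\psi^t$, $(\varphi\to\psi)^t=\Box(\neg\varphi^t\lor\psi^t)$, $(\forall\varphi)^t=\Box\forall\varphi^t$, $(\exists\varphi)^t=\exists\varphi^t$. *)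

theory Defs
  imports "HOL-Algebra.Complete_Lattice"
begin

section \<open>Intuitionistic modal formulas and extensions of MIPC\<close>

datatype ifm =
    ILet nat
  | IBot (\<open>\<bottom>\<^sub>i\<close>)
  | IAnd ifm ifm (infixr \<open>\<and>\<^sub>i\<close> 65)
  | IOr ifm ifm (infixr \<open>\<or>\<^sub>i\<close> 60)
  | IImp ifm ifm (infixr \<open>\<rightarrow>\<^sub>i\<close> 55)
  | IAll ifm (\<open>\<forall>\<^sub>i _\<close> [70] 70)
  | IEx ifm (\<open>\<exists>\<^sub>i _\<close> [70] 70)

abbreviation IIff :: "ifm \<Rightarrow> ifm \<Rightarrow> ifm" (infix \<open>\<leftrightarrow>\<^sub>i\<close> 54)
  where "A \<leftrightarrow>\<^sub>i B \<equiv> (A \<rightarrow>\<^sub>i B) \<and>\<^sub>i (B \<rightarrow>\<^sub>i A)"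

primrec isubst :: "(nat \<Rightarrow> ifm) \<Rightarrow> ifm \<Rightarrow> ifm" where
  "isubst s (ILet n) = s n"
| "isubst s \<bottom>\<^sub>i = \<bottom>\<^sub>i"
| "isubst s (A \<and>\<^sub>i B) = isubst s A \<and>\<^sub>i isubst s B"
| "isubst s (A \<or>\<^sub>i B) = isubst s A \<or>\<^sub>i isubst s B"
| "isubst s (A \<rightarrow>\<^sub>i B) = isubst s A \<rightarrow>\<^sub>i isubst s B"
| "isubst s (\<forall>\<^sub>i A) = \<forall>\<^sub>i (isubst s A)"
| "isubst s (\<exists>\<^sub>i A) = \<exists>\<^sub>i (isubst s A)"

text \<open>The intuitionistic propositional calculus as a Hilbert system. The axiom schemes range over
  all formulas of the modal language, so this is the set of substitution instances of
  the theorems of IPC.\<close>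

inductive_set IPC :: "ifm set" where
  "A \<rightarrow>\<^sub>i B \<rightarrow>\<^sub>i A \<in> IPC"
| "(A \<rightarrow>\<^sub>i B \<rightarrow>\<^sub>i C) \<rightarrow>\<^sub>i (A \<rightarrow>\<^sub>i B) \<rightarrow>\<^sub>i A \<rightarrow>\<^sub>i C \<in> IPC"
| "A \<and>\<^sub>i B \<rightarrow>\<^sub>i A \<in> IPC"
| "A \<and>\<^sub>i B \<rightarrow>\<^sub>i B \<in> IPC"
| "A \<rightarrow>\<^sub>i B \<rightarrow>\<^sub>i A \<and>\<^sub>i B \<in> IPC"
| "A \<rightarrow>\<^sub>i A \<or>\<^sub>i B \<in> IPC"
| "B \<rightarrow>\<^sub>i A \<or>\<^sub>i B \<in> IPC"
| "(A \<rightarrow>\<^sub>i C) \<rightarrow>\<^sub>i (B \<rightarrow>\<^sub>i C) \<rightarrow>\<^sub>i A \<or>\<^sub>i B \<rightarrow>\<^sub>i C \<in> IPC"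
| "\<bottom>\<^sub>i \<rightarrow>\<^sub>i A \<in> IPC"
| "A \<in> IPC \<Longrightarrow> A \<rightarrow>\<^sub>i B \<in> IPC \<Longrightarrow> B \<in> IPC"

definition MIPC_axioms :: "ifm set" where
  "MIPC_axioms = (let p = ILet 0; q = ILet 1 in
    { \<forall>\<^sub>i (p \<and>\<^sub>i q) \<leftrightarrow>\<^sub>i (\<forall>\<^sub>i p \<and>\<^sub>i \<forall>\<^sub>i q),
      \<forall>\<^sub>i p \<rightarrow>\<^sub>i p,
      \<forall>\<^sub>i p \<rightarrow>\<^sub>i \<forall>\<^sub>i (\<forall>\<^sub>i p),
      \<exists>\<^sub>i (p \<or>\<^sub>i q) \<leftrightarrow>\<^sub>i (\<exists>\<^sub>i p \<or>\<^sub>i \<exists>\<^sub>i q),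
      p \<rightarrow>\<^sub>i \<exists>\<^sub>i p,
      \<exists>\<^sub>i (\<exists>\<^sub>i p) \<rightarrow>\<^sub>i \<exists>\<^sub>i p,
      (\<exists>\<^sub>i p \<and>\<^sub>i \<exists>\<^sub>i q) \<rightarrow>\<^sub>i \<exists>\<^sub>i (\<exists>\<^sub>i p \<and>\<^sub>i q),
      \<exists>\<^sub>i (\<forall>\<^sub>i p) \<leftrightarrow>\<^sub>i \<forall>\<^sub>i p,
      \<exists>\<^sub>i p \<leftrightarrow>\<^sub>i \<forall>\<^sub>i (\<exists>\<^sub>i p) })"

definition iclosed :: "ifm set \<Rightarrow> bool" where
  "iclosed L \<longleftrightarrow>
     (\<forall>A B. A \<in> L \<longrightarrow> A \<rightarrow>\<^sub>i B \<in> L \<longrightarrow> B \<in> L) \<and>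
     (\<forall>A s. A \<in> L \<longrightarrow> isubst s A \<in> L) \<and>
     (\<forall>A. A \<in> L \<longrightarrow> \<forall>\<^sub>i A \<in> L)"

definition MIPC :: "ifm set" where
  "MIPC = \<Inter>{L. IPC \<union> MIPC_axioms \<subseteq> L \<and> iclosed L}"

definition iextension :: "ifm set \<Rightarrow> bool" where
  "iextension L \<longleftrightarrow> MIPC \<subseteq> L \<and> iclosed L"


section \<open>Classical bimodal formulas and extensions of MS4\<close>

datatype cfm =
    CLet nat
  | CBot (\<open>\<bottom>\<^sub>c\<close>)
  | CAnd cfm cfm (infixr \<open>\<and>\<^sub>c\<close> 65)
  | COr cfm cfm (infixr \<open>\<or>\<^sub>c\<close> 60)
  | CImp cfm cfm (infixr \<open>\<rightarrow>\<^sub>c\<close> 55)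
  | CBox cfm (\<open>\<box>\<^sub>c _\<close> [70] 70)
  | CAll cfm (\<open>\<forall>\<^sub>c _\<close> [70] 70)

abbreviation CNot :: "cfm \<Rightarrow> cfm" (\<open>\<not>\<^sub>c _\<close> [70] 70)
  where "\<not>\<^sub>c A \<equiv> A \<rightarrow>\<^sub>c \<bottom>\<^sub>c"

abbreviation CEx :: "cfm \<Rightarrow> cfm" (\<open>\<exists>\<^sub>c _\<close> [70] 70)
  where "\<exists>\<^sub>c A \<equiv> \<not>\<^sub>c (\<forall>\<^sub>c (\<not>\<^sub>c A))"

primrec csubst :: "(nat \<Rightarrow> cfm) \<Rightarrow> cfm \<Rightarrow> cfm" where
  "csubst s (CLet n) = s n"
| "csubst s \<bottom>\<^sub>c = \<bottom>\<^sub>c"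
| "csubst s (A \<and>\<^sub>c B) = csubst s A \<and>\<^sub>c csubst s B"
| "csubst s (A \<or>\<^sub>c B) = csubst s A \<or>\<^sub>c csubst s B"
| "csubst s (A \<rightarrow>\<^sub>c B) = csubst s A \<rightarrow>\<^sub>c csubst s B"
| "csubst s (\<box>\<^sub>c A) = \<box>\<^sub>c (csubst s A)"
| "csubst s (\<forall>\<^sub>c A) = \<forall>\<^sub>c (csubst s A)"

inductive_set CPC :: "cfm set" where
  "A \<rightarrow>\<^sub>c B \<rightarrow>\<^sub>c A \<in> CPC"
| "(A \<rightarrow>\<^sub>c B \<rightarrow>\<^sub>c C) \<rightarrow>\<^sub>c (A \<rightarrow>\<^sub>c B) \<rightarrow>\<^sub>c A \<rightarrow>\<^sub>c C \<in> CPC"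
| "A \<and>\<^sub>c B \<rightarrow>\<^sub>c A \<in> CPC"
| "A \<and>\<^sub>c B \<rightarrow>\<^sub>c B \<in> CPC"
| "A \<rightarrow>\<^sub>c B \<rightarrow>\<^sub>c A \<and>\<^sub>c B \<in> CPC"
| "A \<rightarrow>\<^sub>c A \<or>\<^sub>c B \<in> CPC"
| "B \<rightarrow>\<^sub>c A \<or>\<^sub>c B \<in> CPC"
| "(A \<rightarrow>\<^sub>c C) \<rightarrow>\<^sub>c (B \<rightarrow>\<^sub>c C) \<rightarrow>\<^sub>c A \<or>\<^sub>c B \<rightarrow>\<^sub>c C \<in> CPC"
| "\<bottom>\<^sub>c \<rightarrow>\<^sub>c A \<in> CPC"
| "A \<or>\<^sub>c \<not>\<^sub>c A \<in> CPC"
| "A \<in> CPC \<Longrightarrow> A \<rightarrow>\<^sub>c B \<in> CPC \<Longrightarrow> B \<in> CPC"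

definition S4_box_axioms :: "cfm set" where
  "S4_box_axioms = (let p = CLet 0; q = CLet 1 in
    { \<box>\<^sub>c (p \<rightarrow>\<^sub>c q) \<rightarrow>\<^sub>c \<box>\<^sub>c p \<rightarrow>\<^sub>c \<box>\<^sub>c q,
      \<box>\<^sub>c p \<rightarrow>\<^sub>c p,
      \<box>\<^sub>c p \<rightarrow>\<^sub>c \<box>\<^sub>c (\<box>\<^sub>c p) })"

definition S5_all_axioms :: "cfm set" where
  "S5_all_axioms = (let p = CLet 0; q = CLet 1 in
    { \<forall>\<^sub>c (p \<rightarrow>\<^sub>c q) \<rightarrow>\<^sub>c \<forall>\<^sub>c p \<rightarrow>\<^sub>c \<forall>\<^sub>c q,
      \<forall>\<^sub>c p \<rightarrow>\<^sub>c p,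
      \<forall>\<^sub>c p \<rightarrow>\<^sub>c \<forall>\<^sub>c (\<forall>\<^sub>c p),
      \<exists>\<^sub>c p \<rightarrow>\<^sub>c \<forall>\<^sub>c (\<exists>\<^sub>c p) })"

definition bridge_axiom :: cfm where
  "bridge_axiom = (let p = CLet 0 in \<box>\<^sub>c (\<forall>\<^sub>c p) \<rightarrow>\<^sub>c \<forall>\<^sub>c (\<box>\<^sub>c p))"

definition cclosed :: "cfm set \<Rightarrow> bool" where
  "cclosed M \<longleftrightarrow>
     (\<forall>A B. A \<in> M \<longrightarrow> A \<rightarrow>\<^sub>c B \<in> M \<longrightarrow> B \<in> M) \<and>
     (\<forall>A s. A \<in> M \<longrightarrow> csubst s A \<in> M) \<and>
     (\<forall>A. A \<in> M \<longrightarrow> \<box>\<^sub>c A \<in> M) \<and>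
     (\<forall>A. A \<in> M \<longrightarrow> \<forall>\<^sub>c A \<in> M)"

definition MS4 :: "cfm set" where
  "MS4 = \<Inter>{M. CPC \<union> S4_box_axioms \<union> S5_all_axioms \<union> {bridge_axiom} \<subseteq> M \<and> cclosed M}"

definition cextension :: "cfm set \<Rightarrow> bool" where
  "cextension M \<longleftrightarrow> MS4 \<subseteq> M \<and> cclosed M"

definition extend :: "cfm set \<Rightarrow> cfm set \<Rightarrow> cfm set" (infixl \<open>\<oplus>\<^sub>c\<close> 65) where
  "M \<oplus>\<^sub>c \<Gamma> = \<Inter>{N. cextension N \<and> M \<union> \<Gamma> \<subseteq> N}"

definition grz_axiom :: cfm where
  "grz_axiom = (let p = CLet 0 in \<box>\<^sub>c (\<box>\<^sub>c (p \<rightarrow>\<^sub>c \<box>\<^sub>c p) \<rightarrow>\<^sub>c p) \<rightarrow>\<^sub>c p)"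

definition MGrz :: "cfm set" where
  "MGrz = MS4 \<oplus>\<^sub>c {grz_axiom}"


section \<open>Lattices of extensions\<close>

text \<open>Only the order is specified; joins and meets are those of HOL-Algebra, determined by the
  order (see the lemmas below for their concrete descriptions).\<close>

definition Lambda_MIPC :: "ifm set gorder" (\<open>\<Lambda>MIPC\<close>) where
  "\<Lambda>MIPC = \<lparr>carrier = {L. iextension L}, eq = (=), le = (\<subseteq>)\<rparr>"

definition Lambda_MS4 :: "cfm set gorder" (\<open>\<Lambda>MS4\<close>) where
  "\<Lambda>MS4 = \<lparr>carrier = {M. cextension M}, eq = (=), le = (\<subseteq>)\<rparr>"

definition Lambda_MGrz :: "cfm set gorder" (\<open>\<Lambda>MGrz\<close>) where
  "\<Lambda>MGrz = \<lparr>carrier = {M. cextension M \<and> MGrz \<subseteq> M}, eq = (=), le = (\<subseteq>)\<rparr>"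

text \<open>Both \<^const>\<open>join_pres\<close> and \<^const>\<open>meet_pres\<close> include that source and target are lattices.\<close>

definition lattice_hom :: "('a, 'c) gorder_scheme \<Rightarrow> ('b, 'd) gorder_scheme \<Rightarrow> ('a \<Rightarrow> 'b) \<Rightarrow> bool"
  where "lattice_hom X Y f \<longleftrightarrow>
    f \<in> carrier X \<rightarrow> carrier Y \<and> join_pres X Y f \<and> meet_pres X Y f"

lemma closure_order:
  fixes P :: "'a set \<Rightarrow> bool"
  assumes inter: "\<And>\<A>. (\<And>L. L \<in> \<A> \<Longrightarrow> P L) \<Longrightarrow> P (\<Inter>\<A>)"
  defines "X \<equiv> \<lparr>carrier = {L. P L}, eq = (=), le = (\<subseteq>)\<rparr>"
  shows "complete_lattice X"
    and "P L \<Longrightarrow> P L' \<Longrightarrow> L \<sqinter>\<^bsub>X\<^esub> L' = L \<inter> L'"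
    and "P L \<Longrightarrow> P L' \<Longrightarrow> L \<squnion>\<^bsub>X\<^esub> L' = \<Inter>{N. P N \<and> L \<union> L' \<subseteq> N}"
proof -
  interpret partial_order X
    by unfold_locales (auto simp: X_def)
  have lub: "least X (\<Inter>{N. P N \<and> \<Union>\<A> \<subseteq> N}) (Upper X \<A>)" if "\<A> \<subseteq> carrier X" for \<A>
    using that inter[of "{N. P N \<and> \<Union>\<A> \<subseteq> N}"] unfolding least_def Upper_def X_def by auto
  have glb: "greatest X (\<Inter>\<A>) (Lower X \<A>)" if "\<A> \<subseteq> carrier X" for \<A>
    using that inter[of \<A>] unfolding greatest_def Lower_def X_def by auto
  show "complete_lattice X"
    by (rule complete_latticeI) (use lub glb in blast)+
  show "L \<sqinter>\<^bsub>X\<^esub> L' = L \<inter> L'" if "P L" "P L'"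
  proof -
    have "greatest X (L \<inter> L') (Lower X {L, L'})"
      using glb[of "{L, L'}"] that by (auto simp: X_def)
    then show ?thesis
      unfolding meet_def inf_def by (metis (mono_tags, lifting) greatest_unique someI)
  qed
  show "L \<squnion>\<^bsub>X\<^esub> L' = \<Inter>{N. P N \<and> L \<union> L' \<subseteq> N}" if "P L" "P L'"
  proof -
    have "least X (\<Inter>{N. P N \<and> L \<union> L' \<subseteq> N}) (Upper X {L, L'})"
      using lub[of "{L, L'}"] that by (auto simp: X_def)
    then show ?thesis
      unfolding join_def sup_def by (metis (mono_tags, lifting) least_unique someI)
  qed
qed

lemma iextension_Inter: "(\<And>L. L \<in> \<A> \<Longrightarrow> iextension L) \<Longrightarrow> iextension (\<Inter>\<A>)"
  unfolding iextension_def iclosed_def by blast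

lemma cextension_Inter: "(\<And>L. L \<in> \<A> \<Longrightarrow> cextension L) \<Longrightarrow> cextension (\<Inter>\<A>)"
  unfolding cextension_def cclosed_def by blast

lemmas Lambda_MIPC_lattice = closure_order[where P = iextension, OF iextension_Inter, folded Lambda_MIPC_def]

lemmas Lambda_MS4_lattice = closure_order[where P = cextension, OF cextension_Inter, folded Lambda_MS4_def]

lemma MGrz_extension_Inter:
  "(\<And>L. L \<in> \<A> \<Longrightarrow> cextension L \<and> MGrz \<subseteq> L) \<Longrightarrow> cextension (\<Inter>\<A>) \<and> MGrz \<subseteq> \<Inter>\<A>"
  using cextension_Inter[of \<A>] by blast

lemmas Lambda_MGrz_lattice =
  closure_order[where P = "\<lambda>M. cextension M \<and> MGrz \<subseteq> M", OF MGrz_extension_Inter, folded Lambda_MGrz_def]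


section \<open>The translation and the induced maps on logics\<close>

primrec goedel :: "ifm \<Rightarrow> cfm" (\<open>_\<^sup>t\<close> [1000] 999) where
  "(ILet n)\<^sup>t = \<box>\<^sub>c (CLet n)"
| "\<bottom>\<^sub>i\<^sup>t = \<bottom>\<^sub>c"
| "(A \<and>\<^sub>i B)\<^sup>t = A\<^sup>t \<and>\<^sub>c B\<^sup>t"
| "(A \<or>\<^sub>i B)\<^sup>t = A\<^sup>t \<or>\<^sub>c B\<^sup>t"
| "(A \<rightarrow>\<^sub>i B)\<^sup>t = \<box>\<^sub>c (\<not>\<^sub>c A\<^sup>t \<or>\<^sub>c B\<^sup>t)"
| "(\<forall>\<^sub>i A)\<^sup>t = \<box>\<^sub>c (\<forall>\<^sub>c A\<^sup>t)"
| "(\<exists>\<^sub>i A)\<^sup>t = \<exists>\<^sub>c A\<^sup>t"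

definition tau :: "ifm set \<Rightarrow> cfm set" (\<open>\<tau>\<close>) where
  "\<tau> L = MS4 \<oplus>\<^sub>c {A\<^sup>t | A. A \<in> L}"

definition sigma :: "ifm set \<Rightarrow> cfm set" (\<open>\<sigma>\<close>) where
  "\<sigma> L = MGrz \<oplus>\<^sub>c {A\<^sup>t | A. A \<in> L}"

end

theory Submission
  imports Defs
begin

text \<open>
  Both maps have the form \<open>L \<mapsto> N \<oplus>\<^sub>c {A\<^sup>t | A. A \<in> L}\<close> for a fixed base \<open>N\<close>, and the argument is the same
  for every base.

  Joins are preserved because the map is a left adjoint. Its right adjoint sends \<open>M\<close> to
  \<open>{A. A\<^sup>t \<in> M}\<close>, and the point is that this set is an extension of MIPC
  (\<open>iextension_goedel_preimage\<close>): the translation is sound, and it commutes with substitution up to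
  provable equivalence. Both facts are read off the canonical frame of \<open>M\<close>, whose points are the
  prime theories containing \<open>M\<close>. By \<open>goedel_persistent\<close>, translated formulas are upsets there, which
  makes their behaviour that of formulas in an intuitionistic Kripke model.

  Meets are intersections, and only \<open>goedel_extend N L \<inter> goedel_extend N L' \<subseteq> goedel_extend N (L \<inter> L')\<close>
  needs an argument. If \<open>A \<in> L\<close> and \<open>B \<in> L'\<close>, then \<open>\<forall>A \<or> \<forall>B\<close> lies in \<open>L \<inter> L'\<close>, and its translation is
  \<open>\<box>\<forall>A\<^sup>t \<or> \<box>\<forall>B\<^sup>t\<close>. After renaming, \<open>A\<close> and \<open>B\<close> have no letters in common, so that arbitrary
  substitutions may be applied to the two disjuncts separately (\<open>goedel_global_disjunction\<close>). Such a disjunction of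
  global assertions survives the passage from generators to their consequences, one
  disjunct at a time (\<open>extend_global_disjunction\<close>). A formula \<open>C\<close> in both extensions therefore
  satisfies \<open>\<box>\<forall>C \<or> \<box>\<forall>C\<close>, and hence \<open>C\<close>, in \<open>goedel_extend N (L \<inter> L')\<close>.
\<close>

section \<open>Prime theories of classical logic\<close>

definition ctheory :: "cfm set \<Rightarrow> bool" where
  "ctheory T \<longleftrightarrow> CPC \<subseteq> T \<and> (\<forall>A B. A \<in> T \<longrightarrow> A \<rightarrow>\<^sub>c B \<in> T \<longrightarrow> B \<in> T)"

definition prime_theory :: "cfm set \<Rightarrow> bool" where
  "prime_theory w \<longleftrightarrow> ctheory w \<and> \<bottom>\<^sub>c \<notin> w \<and> (\<forall>A. A \<in> w \<or> \<not>\<^sub>c A \<in> w)"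

lemma ctheory_CPC: "ctheory T \<Longrightarrow> A \<in> CPC \<Longrightarrow> A \<in> T"
  unfolding ctheory_def by blast

lemma ctheory_mp: "ctheory T \<Longrightarrow> A \<rightarrow>\<^sub>c B \<in> T \<Longrightarrow> A \<in> T \<Longrightarrow> B \<in> T"
  unfolding ctheory_def by blast

lemmas ctheory_axiom = CPC.intros(1-10)[THEN ctheory_CPC[rotated]]

lemma ctheory_weaken: "ctheory T \<Longrightarrow> B \<in> T \<Longrightarrow> A \<rightarrow>\<^sub>c B \<in> T"
  using ctheory_axiom(1) ctheory_mp by blast

lemma ctheory_mp_under:
  "ctheory T \<Longrightarrow> A \<rightarrow>\<^sub>c B \<rightarrow>\<^sub>c C \<in> T \<Longrightarrow> A \<rightarrow>\<^sub>c B \<in> T \<Longrightarrow> A \<rightarrow>\<^sub>c C \<in> T"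
  using ctheory_axiom(2) ctheory_mp by blast

lemma ctheory_imp_refl: "ctheory T \<Longrightarrow> A \<rightarrow>\<^sub>c A \<in> T"
  by (meson ctheory_axiom(1) ctheory_mp_under)

lemma ctheory_or_elim:
  "ctheory T \<Longrightarrow> A \<rightarrow>\<^sub>c C \<in> T \<Longrightarrow> B \<rightarrow>\<^sub>c C \<in> T \<Longrightarrow> A \<or>\<^sub>c B \<in> T \<Longrightarrow> C \<in> T"
  by (meson ctheory_axiom(8) ctheory_mp)

text \<open>This is the deduction theorem: the formulas that follow from \<open>T\<close> under the additional
  hypothesis \<open>B\<close> are again a theory.\<close>

lemma ctheory_adjoin:
  assumes "ctheory T"
  shows "ctheory {C. B \<rightarrow>\<^sub>c C \<in> T}"
  unfolding ctheory_def
  using ctheory_CPC[OF assms] ctheory_weaken[OF assms] ctheory_mp_under[OF assms] by blast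

text \<open>A theory that is maximal among those omitting \<open>A\<close> is prime: if it omits both \<open>B\<close> and \<open>\<not>B\<close>,
  then adjoining either of them proves \<open>A\<close>, and excluded middle puts \<open>A\<close> into the theory.\<close>

lemma prime_theory_separation:
  assumes T: "ctheory T" and A: "A \<notin> T"
  obtains w where "prime_theory w" "T \<subseteq> w" "A \<notin> w"
proof -
  define \<A> where "\<A> = {U. ctheory U \<and> T \<subseteq> U \<and> A \<notin> U}"
  have "\<exists>w\<in>\<A>. \<forall>U\<in>\<A>. w \<subseteq> U \<longrightarrow> U = w"
  proof (rule subset_Zorn_nonempty)
    show "\<A> \<noteq> {}" using T A by (auto simp: \<A>_def)
    fix \<C> assume C: "\<C> \<noteq> {}" "subset.chain \<A> \<C>"
    have sub: "U \<in> \<A>" if "U \<in> \<C>" for U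
      using C(2) that by (auto simp: subset.chain_def)
    have "C \<in> \<Union>\<C>" if BC: "B \<in> \<Union>\<C>" "B \<rightarrow>\<^sub>c C \<in> \<Union>\<C>" for B C
    proof -
      obtain U V where "U \<in> \<C>" "V \<in> \<C>" "B \<in> U" "B \<rightarrow>\<^sub>c C \<in> V"
        using BC by blast
      moreover from this have "U \<subseteq> V \<or> V \<subseteq> U"
        using C(2) by (metis subset_chain_def)
      ultimately show ?thesis
        using sub ctheory_mp unfolding \<A>_def by blast
    qed
    then show "\<Union>\<C> \<in> \<A>"
      using C(1) sub unfolding \<A>_def ctheory_def by blast
  qed
  then obtain w where "w \<in> \<A>" and maximal: "\<And>U. U \<in> \<A> \<Longrightarrow> w \<subseteq> U \<Longrightarrow> U = w"
    by blast
  then have w: "ctheory w" "T \<subseteq> w" "A \<notin> w"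
    by (simp_all add: \<A>_def)
  have forced: "B \<rightarrow>\<^sub>c A \<in> w" if "B \<notin> w" for B
  proof (rule ccontr)
    assume "B \<rightarrow>\<^sub>c A \<notin> w"
    moreover have "w \<subseteq> {C. B \<rightarrow>\<^sub>c C \<in> w}"
      using ctheory_weaken[OF w(1)] by blast
    ultimately have "{C. B \<rightarrow>\<^sub>c C \<in> w} = w"
      using maximal ctheory_adjoin[OF w(1)] w(2) unfolding \<A>_def by blast
    then show False using ctheory_imp_refl[OF w(1), of B] that by blast
  qed
  have "\<bottom>\<^sub>c \<notin> w"
    using w ctheory_axiom(9) ctheory_mp by blast
  moreover have "B \<in> w \<or> \<not>\<^sub>c B \<in> w" for B
    using forced ctheory_or_elim ctheory_axiom(10) w(1,3) by blast
  ultimately show thesis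
    using that w unfolding prime_theory_def by blast
qed

lemma prime_bot: "prime_theory w \<Longrightarrow> \<bottom>\<^sub>c \<notin> w"
  unfolding prime_theory_def by blast

lemma prime_and: "prime_theory w \<Longrightarrow> A \<and>\<^sub>c B \<in> w \<longleftrightarrow> A \<in> w \<and> B \<in> w"
  unfolding prime_theory_def by (meson ctheory_axiom(3-5) ctheory_mp)

lemma prime_imp:
  assumes "prime_theory w"
  shows "A \<rightarrow>\<^sub>c B \<in> w \<longleftrightarrow> (A \<in> w \<longrightarrow> B \<in> w)"
proof -
  have w: "ctheory w" and dec: "A \<in> w \<or> \<not>\<^sub>c A \<in> w"
    using assms unfolding prime_theory_def by blast+
  have "A \<rightarrow>\<^sub>c \<bottom>\<^sub>c \<rightarrow>\<^sub>c B \<in> w"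
    by (intro ctheory_weaken w ctheory_axiom(9))
  then show ?thesis
    using dec ctheory_mp[OF w] ctheory_weaken[OF w] ctheory_mp_under[OF w] by blast
qed

lemma prime_or: "prime_theory w \<Longrightarrow> A \<or>\<^sub>c B \<in> w \<longleftrightarrow> A \<in> w \<or> B \<in> w"
  unfolding prime_theory_def
  by (meson ctheory_axiom(6,7) ctheory_mp ctheory_or_elim)

lemmas prime_simps = prime_bot prime_and prime_imp prime_or

text \<open>For a normal operator \<open>f\<close>, the formulas \<open>A\<close> with \<open>f A\<close> in \<open>w\<close> are a theory, so separation
  applied to this theory yields the successors that the truth lemma for \<open>f\<close> asks for.\<close>

lemma normal_operator_truth:
  assumes w: "prime_theory w"
    and K: "\<And>A B. f (A \<rightarrow>\<^sub>c B) \<rightarrow>\<^sub>c f A \<rightarrow>\<^sub>c f B \<in> w"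
    and nec: "\<And>A. A \<in> CPC \<Longrightarrow> f A \<in> w"
  shows "f A \<in> w \<longleftrightarrow> (\<forall>v. prime_theory v \<and> {B. f B \<in> w} \<subseteq> v \<longrightarrow> A \<in> v)"
proof -
  have "ctheory {B. f B \<in> w}"
    unfolding ctheory_def using K nec by (auto simp: prime_simps[OF w])
  then show ?thesis
    using prime_theory_separation[of "{B. f B \<in> w}" A] by blast
qed


section \<open>The canonical frame of an extension of MS4\<close>

lemma csubst_comp: "csubst s (csubst r A) = csubst (\<lambda>n. csubst s (r n)) A"
  by (induction A) auto

lemma csubst_letters: "csubst CLet A = A"
  by (induction A) auto

locale ms4_extension =
  fixes M :: "cfm set"
  assumes extension: "cextension M"
begin

lemma mp: "A \<rightarrow>\<^sub>c B \<in> M \<Longrightarrow> A \<in> M \<Longrightarrow> B \<in> M"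
  and subst: "A \<in> M \<Longrightarrow> csubst s A \<in> M"
  and nec_box: "A \<in> M \<Longrightarrow> \<box>\<^sub>c A \<in> M"
  and nec_all: "A \<in> M \<Longrightarrow> \<forall>\<^sub>c A \<in> M"
  using extension unfolding cextension_def cclosed_def by blast+

lemma axioms_sub: "CPC \<union> S4_box_axioms \<union> S5_all_axioms \<union> {bridge_axiom} \<subseteq> M"
  using extension unfolding cextension_def MS4_def by blast

lemma theory_M: "ctheory M"
  using axioms_sub mp unfolding ctheory_def by blast

lemma axiom_instances:
  shows "\<box>\<^sub>c (A \<rightarrow>\<^sub>c B) \<rightarrow>\<^sub>c \<box>\<^sub>c A \<rightarrow>\<^sub>c \<box>\<^sub>c B \<in> M"
    and "\<box>\<^sub>c A \<rightarrow>\<^sub>c A \<in> M"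
    and "\<box>\<^sub>c A \<rightarrow>\<^sub>c \<box>\<^sub>c (\<box>\<^sub>c A) \<in> M"
    and "\<forall>\<^sub>c (A \<rightarrow>\<^sub>c B) \<rightarrow>\<^sub>c \<forall>\<^sub>c A \<rightarrow>\<^sub>c \<forall>\<^sub>c B \<in> M"
    and "\<forall>\<^sub>c A \<rightarrow>\<^sub>c A \<in> M"
    and "\<forall>\<^sub>c A \<rightarrow>\<^sub>c \<forall>\<^sub>c (\<forall>\<^sub>c A) \<in> M"
    and "\<exists>\<^sub>c A \<rightarrow>\<^sub>c \<forall>\<^sub>c (\<exists>\<^sub>c A) \<in> M"
    and "\<box>\<^sub>c (\<forall>\<^sub>c A) \<rightarrow>\<^sub>c \<forall>\<^sub>c (\<box>\<^sub>c A) \<in> M"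
proof -
  let ?s = "\<lambda>n. if n = 0 then A else B"
  have inst: "csubst ?s C \<in> M" if "C \<in> S4_box_axioms \<union> S5_all_axioms \<union> {bridge_axiom}" for C
    using that axioms_sub subst by blast
  note defs = S4_box_axioms_def S5_all_axioms_def bridge_axiom_def Let_def
  show "\<box>\<^sub>c (A \<rightarrow>\<^sub>c B) \<rightarrow>\<^sub>c \<box>\<^sub>c A \<rightarrow>\<^sub>c \<box>\<^sub>c B \<in> M"
    using inst[of "\<box>\<^sub>c (CLet 0 \<rightarrow>\<^sub>c CLet 1) \<rightarrow>\<^sub>c \<box>\<^sub>c (CLet 0) \<rightarrow>\<^sub>c \<box>\<^sub>c (CLet 1)"]
    by (simp add: defs)
  show "\<box>\<^sub>c A \<rightarrow>\<^sub>c A \<in> M"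
    using inst[of "\<box>\<^sub>c (CLet 0) \<rightarrow>\<^sub>c CLet 0"] by (simp add: defs)
  show "\<box>\<^sub>c A \<rightarrow>\<^sub>c \<box>\<^sub>c (\<box>\<^sub>c A) \<in> M"
    using inst[of "\<box>\<^sub>c (CLet 0) \<rightarrow>\<^sub>c \<box>\<^sub>c (\<box>\<^sub>c (CLet 0))"] by (simp add: defs)
  show "\<forall>\<^sub>c (A \<rightarrow>\<^sub>c B) \<rightarrow>\<^sub>c \<forall>\<^sub>c A \<rightarrow>\<^sub>c \<forall>\<^sub>c B \<in> M"
    using inst[of "\<forall>\<^sub>c (CLet 0 \<rightarrow>\<^sub>c CLet 1) \<rightarrow>\<^sub>c \<forall>\<^sub>c (CLet 0) \<rightarrow>\<^sub>c \<forall>\<^sub>c (CLet 1)"]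
    by (simp add: defs)
  show "\<forall>\<^sub>c A \<rightarrow>\<^sub>c A \<in> M"
    using inst[of "\<forall>\<^sub>c (CLet 0) \<rightarrow>\<^sub>c CLet 0"] by (simp add: defs)
  show "\<forall>\<^sub>c A \<rightarrow>\<^sub>c \<forall>\<^sub>c (\<forall>\<^sub>c A) \<in> M"
    using inst[of "\<forall>\<^sub>c (CLet 0) \<rightarrow>\<^sub>c \<forall>\<^sub>c (\<forall>\<^sub>c (CLet 0))"] by (simp add: defs)
  show "\<exists>\<^sub>c A \<rightarrow>\<^sub>c \<forall>\<^sub>c (\<exists>\<^sub>c A) \<in> M"
    using inst[of "\<exists>\<^sub>c (CLet 0) \<rightarrow>\<^sub>c \<forall>\<^sub>c (\<exists>\<^sub>c (CLet 0))"] by (simp add: defs)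
  show "\<box>\<^sub>c (\<forall>\<^sub>c A) \<rightarrow>\<^sub>c \<forall>\<^sub>c (\<box>\<^sub>c A) \<in> M"
    using inst[of bridge_axiom] by (simp add: defs)
qed

definition W :: "cfm set set" where
  "W = {w. prime_theory w \<and> M \<subseteq> w}"

text \<open>The frame condition that corresponds to the bridge axiom, \<open>E\<close> followed by \<open>R\<close> being
  contained in \<open>R\<close> followed by \<open>E\<close>, is replaced by the statement \<open>box_all_invariant\<close>
  about membership of formulas in points.\<close>

definition R :: "cfm set \<Rightarrow> cfm set \<Rightarrow> bool" where
  "R w v \<longleftrightarrow> v \<in> W \<and> {A. \<box>\<^sub>c A \<in> w} \<subseteq> v"

definition E :: "cfm set \<Rightarrow> cfm set \<Rightarrow> bool" where
  "E w v \<longleftrightarrow> v \<in> W \<and> {A. \<forall>\<^sub>c A \<in> w} \<subseteq> v"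

lemma provable_iff: "A \<in> M \<longleftrightarrow> (\<forall>w\<in>W. A \<in> w)"
  using prime_theory_separation[OF theory_M, of A] unfolding W_def by blast

lemma R_W: "R w v \<Longrightarrow> v \<in> W" and E_W: "E w v \<Longrightarrow> v \<in> W"
  by (simp_all add: R_def E_def)

context
  fixes w assumes w: "w \<in> W"
begin

lemma prime_w: "prime_theory w" and M_w: "M \<subseteq> w"
  using w by (simp_all add: W_def)

lemma truth_prop [simp]:
  shows "\<bottom>\<^sub>c \<notin> w"
    and "A \<and>\<^sub>c B \<in> w \<longleftrightarrow> A \<in> w \<and> B \<in> w"
    and "A \<or>\<^sub>c B \<in> w \<longleftrightarrow> A \<in> w \<or> B \<in> w"
    and "A \<rightarrow>\<^sub>c B \<in> w \<longleftrightarrow> (A \<in> w \<longrightarrow> B \<in> w)"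
  by (simp_all add: prime_simps[OF prime_w])

lemma truth_box: "\<box>\<^sub>c A \<in> w \<longleftrightarrow> (\<forall>v. R w v \<longrightarrow> A \<in> v)"
proof -
  have "M \<subseteq> v" if "{B. \<box>\<^sub>c B \<in> w} \<subseteq> v" for v
    using that nec_box M_w by blast
  then have "R w v \<longleftrightarrow> prime_theory v \<and> {B. \<box>\<^sub>c B \<in> w} \<subseteq> v" for v
    unfolding R_def W_def by blast
  then show ?thesis
    using normal_operator_truth[OF prime_w, of CBox A] axiom_instances(1) nec_box axioms_sub M_w
    by (simp only:) blast
qed

lemma truth_all: "\<forall>\<^sub>c A \<in> w \<longleftrightarrow> (\<forall>v. E w v \<longrightarrow> A \<in> v)"
proof -
  have "M \<subseteq> v" if "{B. \<forall>\<^sub>c B \<in> w} \<subseteq> v" for v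
    using that nec_all M_w by blast
  then have "E w v \<longleftrightarrow> prime_theory v \<and> {B. \<forall>\<^sub>c B \<in> w} \<subseteq> v" for v
    unfolding E_def W_def by blast
  then show ?thesis
    using normal_operator_truth[OF prime_w, of CAll A] axiom_instances(4) nec_all axioms_sub M_w
    by (simp only:) blast
qed

lemma axiom_in_w: "A \<rightarrow>\<^sub>c B \<in> M \<Longrightarrow> A \<in> w \<Longrightarrow> B \<in> w"
  using M_w truth_prop(4) by blast

lemma R_refl: "R w w"
  unfolding R_def using w axiom_in_w[OF axiom_instances(2)] by blast

lemma E_refl: "E w w"
  unfolding E_def using w axiom_in_w[OF axiom_instances(5)] by blast

lemma R_trans: "R w v \<Longrightarrow> R v u \<Longrightarrow> R w u"
  unfolding R_def using axiom_in_w[OF axiom_instances(3)] by blast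

lemma E_trans: "E w v \<Longrightarrow> E v u \<Longrightarrow> E w u"
  unfolding E_def using axiom_in_w[OF axiom_instances(6)] by blast

end

lemma truth_ex:
  assumes "w \<in> W"
  shows "\<exists>\<^sub>c A \<in> w \<longleftrightarrow> (\<exists>v. E w v \<and> A \<in> v)"
proof -
  have "\<not>\<^sub>c A \<in> v \<longleftrightarrow> A \<notin> v" if "E w v" for v
    using E_W[OF that] by simp
  then show ?thesis
    using truth_all[OF assms, of "\<not>\<^sub>c A"] assms by auto
qed

lemma E_sym:
  assumes w: "w \<in> W" and E: "E w v"
  shows "E v w"
proof -
  have "A \<in> w" if A: "\<forall>\<^sub>c A \<in> v" for A
  proof (rule ccontr)
    assume "A \<notin> w"
    then have "\<not>\<^sub>c A \<in> w" by (simp add: w)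
    then have "\<exists>\<^sub>c (\<not>\<^sub>c A) \<in> w"
      unfolding truth_ex[OF w] using E_refl[OF w] by blast
    then have "\<exists>\<^sub>c (\<not>\<^sub>c A) \<in> v"
      using axiom_in_w[OF w axiom_instances(7)] E unfolding E_def by blast
    then obtain u where u: "E v u" "\<not>\<^sub>c A \<in> u"
      unfolding truth_ex[OF E_W[OF E]] by blast
    then have "A \<in> u"
      using A truth_all[OF E_W[OF E]] by blast
    then show False
      using u E_W[OF u(1)] by simp
  qed
  then show ?thesis using w unfolding E_def by blast
qed

lemma truth_box_all:
  assumes "w \<in> W"
  shows "\<box>\<^sub>c (\<forall>\<^sub>c A) \<in> w \<longleftrightarrow> (\<forall>v u. R w v \<longrightarrow> E v u \<longrightarrow> A \<in> u)"
  unfolding truth_box[OF assms] using truth_all R_W by blast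

lemma box_all_all:
  assumes w: "w \<in> W" and A: "\<box>\<^sub>c (\<forall>\<^sub>c A) \<in> w"
  shows "\<box>\<^sub>c (\<forall>\<^sub>c (\<forall>\<^sub>c A)) \<in> w"
proof -
  have "\<forall>\<^sub>c A \<in> u" if "R w v" "E v u" for v u
    using that A E_trans R_W E_W unfolding truth_box_all[OF w] truth_all[OF E_W[OF that(2)]] by blast
  then show ?thesis unfolding truth_box_all[OF w] by blast
qed

text \<open>The bridge axiom turns \<open>\<box>\<forall>A \<rightarrow> \<box>\<forall>\<forall>A\<close> into \<open>\<box>\<forall>A \<rightarrow> \<forall>\<box>\<forall>A\<close>. All uses of the bridge axiom
  below go through this form of it.\<close>

lemma box_all_invariant:
  assumes w: "w \<in> W" and "E w v" and A: "\<box>\<^sub>c (\<forall>\<^sub>c A) \<in> w"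
  shows "\<box>\<^sub>c (\<forall>\<^sub>c A) \<in> v"
proof -
  have "\<box>\<^sub>c (\<forall>\<^sub>c (\<forall>\<^sub>c A)) \<in> w"
    by (rule box_all_all[OF w A])
  then have "\<forall>\<^sub>c (\<box>\<^sub>c (\<forall>\<^sub>c A)) \<in> w"
    using axiom_in_w[OF w axiom_instances(8)] by blast
  then show ?thesis
    using w truth_all assms(2) by blast
qed

lemma box_persistent:
  assumes "w \<in> W" "R w v" "\<box>\<^sub>c A \<in> w"
  shows "\<box>\<^sub>c A \<in> v"
  using assms(2,3) R_trans[OF assms(1)] R_W
  unfolding truth_box[OF assms(1)] truth_box[OF R_W[OF assms(2)]] by blast

lemma box_all_elim:
  assumes "w \<in> W" "\<box>\<^sub>c (\<forall>\<^sub>c A) \<in> w"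
  shows "A \<in> w"
  using assms R_refl E_refl unfolding truth_box_all[OF assms(1)] by blast

lemma box_all_box:
  assumes w: "w \<in> W" and A: "\<box>\<^sub>c (\<forall>\<^sub>c A) \<in> w"
  shows "\<box>\<^sub>c (\<forall>\<^sub>c (\<box>\<^sub>c A)) \<in> w"
proof -
  have "\<box>\<^sub>c A \<in> u" if "R w v" "E v u" for v u
  proof -
    have "v \<in> W" "u \<in> W" using that R_W E_W by blast+
    then have "\<box>\<^sub>c (\<forall>\<^sub>c A) \<in> u"
      using that w A box_persistent box_all_invariant by blast
    then have "A \<in> x" if "R u x" for x
      using box_all_elim[OF R_W[OF that]] box_persistent[OF \<open>u \<in> W\<close> that] by blast
    then show ?thesis
      unfolding truth_box[OF \<open>u \<in> W\<close>] by blast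
  qed
  then show ?thesis unfolding truth_box_all[OF w] by blast
qed

lemma box_all_mp:
  assumes w: "w \<in> W" and "\<box>\<^sub>c (\<forall>\<^sub>c A) \<in> w" "\<box>\<^sub>c (\<forall>\<^sub>c (A \<rightarrow>\<^sub>c B)) \<in> w"
  shows "\<box>\<^sub>c (\<forall>\<^sub>c B) \<in> w"
proof -
  have "B \<in> u" if "R w v" "E v u" for u v
  proof -
    have "A \<in> u" "A \<rightarrow>\<^sub>c B \<in> u"
      using that assms truth_box truth_all R_W by blast+
    then show ?thesis using that E_W truth_prop(4) by blast
  qed
  then show ?thesis using w truth_box truth_all R_W by metis
qed


section \<open>Soundness of the translation\<close>

text \<open>Translated formulas are upsets of the canonical frame, as in Kripke models of intuitionistic
  logic. For the existential modality this is the law \<open>\<exists>\<box>A \<rightarrow> \<box>\<exists>A\<close>: if \<open>\<box>A\<close> holds at a point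
  \<open>E\<close>-related to \<open>w\<close>, then that point satisfies \<open>\<box>\<forall>\<exists>A\<close>, and hence so does \<open>w\<close>.\<close>

lemma goedel_persistent:
  assumes "w \<in> W" "R w v" "A\<^sup>t \<in> w"
  shows "A\<^sup>t \<in> v"
  using assms
proof (induction A arbitrary: w v)
  case (ILet n)
  show ?case using box_persistent[OF ILet(1,2)] ILet(3) by simp
next
  case (IImp A B)
  show ?case using box_persistent[OF IImp.prems(1,2)] IImp.prems(3) by simp
next
  case (IAll A)
  show ?case using box_persistent[OF IAll.prems(1,2)] IAll.prems(3) by simp
next
  case (IEx A)
  then obtain u where u: "E w u" "A\<^sup>t \<in> u" "u \<in> W"
    using truth_ex E_W by auto
  have "\<exists>\<^sub>c A\<^sup>t \<in> y" if "R u x" "E x y" for x y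
  proof -
    have "A\<^sup>t \<in> x" "E y x" "y \<in> W"
      using IEx.IH[OF u(3) that(1) u(2)] that E_sym R_W E_W by blast+
    then show ?thesis using truth_ex by blast
  qed
  then have "\<box>\<^sub>c (\<forall>\<^sub>c (\<exists>\<^sub>c A\<^sup>t)) \<in> u"
    using truth_box[OF u(3)] truth_all R_W by blast
  then have "\<box>\<^sub>c (\<forall>\<^sub>c (\<exists>\<^sub>c A\<^sup>t)) \<in> w"
    using box_all_invariant E_sym u IEx.prems(1) by blast
  then have "\<exists>\<^sub>c A\<^sup>t \<in> v"
    using box_persistent[OF IEx.prems(1,2)] box_all_elim[OF R_W[OF IEx.prems(2)]] by blast
  then show ?case by simp
qed (auto simp: R_W)

lemma truth_goedel_imp:
  assumes "w \<in> W"
  shows "(A \<rightarrow>\<^sub>i B)\<^sup>t \<in> w \<longleftrightarrow> (\<forall>v. R w v \<longrightarrow> A\<^sup>t \<in> v \<longrightarrow> B\<^sup>t \<in> v)"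
  using assms R_W by (auto simp: truth_box)

lemma truth_goedel_all:
  assumes "w \<in> W"
  shows "(\<forall>\<^sub>i A)\<^sup>t \<in> w \<longleftrightarrow> (\<forall>v u. R w v \<longrightarrow> E v u \<longrightarrow> A\<^sup>t \<in> u)"
  using assms R_W truth_box truth_all by (metis goedel.simps(6))

lemma truth_goedel_ex:
  assumes "w \<in> W"
  shows "(\<exists>\<^sub>i A)\<^sup>t \<in> w \<longleftrightarrow> (\<exists>v. E w v \<and> A\<^sup>t \<in> v)"
  using assms truth_ex by simp

text \<open>Since translated formulas are upsets, an implication is valid as soon as it holds pointwise.\<close>

lemma goedel_imp_provable:
  "(A \<rightarrow>\<^sub>i B)\<^sup>t \<in> M \<longleftrightarrow> (\<forall>w\<in>W. A\<^sup>t \<in> w \<longrightarrow> B\<^sup>t \<in> w)"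
proof -
  have "(A \<rightarrow>\<^sub>i B)\<^sup>t \<in> w" if "\<forall>w\<in>W. A\<^sup>t \<in> w \<longrightarrow> B\<^sup>t \<in> w" "w \<in> W" for w
    unfolding truth_goedel_imp[OF that(2)] using that(1) R_W by blast
  moreover have "B\<^sup>t \<in> w" if "(A \<rightarrow>\<^sub>i B)\<^sup>t \<in> w" "w \<in> W" "A\<^sup>t \<in> w" for w
    using that(1,3) R_refl[OF that(2)] unfolding truth_goedel_imp[OF that(2)] by blast
  ultimately show ?thesis unfolding provable_iff by metis
qed

lemma goedel_iff_provable:
  "(A \<leftrightarrow>\<^sub>i B)\<^sup>t \<in> M \<longleftrightarrow> (\<forall>w\<in>W. A\<^sup>t \<in> w \<longleftrightarrow> B\<^sup>t \<in> w)"
proof -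
  have "(A \<leftrightarrow>\<^sub>i B)\<^sup>t \<in> M \<longleftrightarrow> (A \<rightarrow>\<^sub>i B)\<^sup>t \<in> M \<and> (B \<rightarrow>\<^sub>i A)\<^sup>t \<in> M"
    unfolding provable_iff by (auto simp del: goedel.simps(5))
  then show ?thesis unfolding goedel_imp_provable by blast
qed

lemma goedel_mp: "A\<^sup>t \<in> M \<Longrightarrow> (A \<rightarrow>\<^sub>i B)\<^sup>t \<in> M \<Longrightarrow> B\<^sup>t \<in> M"
  unfolding goedel_imp_provable unfolding provable_iff by simp

lemma goedel_IPC: "A \<in> IPC \<Longrightarrow> A\<^sup>t \<in> M"
proof (induction rule: IPC.induct)
  case (10 A B)
  show ?case by (rule goedel_mp[OF 10(3,4)])
next
  case (1 A B)
  then show ?case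
    unfolding goedel_imp_provable using truth_goedel_imp goedel_persistent by blast
next
  case (2 A B C)
  have "C\<^sup>t \<in> x"
    if "w \<in> W" "R w v" "R v x" "(A \<rightarrow>\<^sub>i B \<rightarrow>\<^sub>i C)\<^sup>t \<in> w" "(A \<rightarrow>\<^sub>i B)\<^sup>t \<in> v" "A\<^sup>t \<in> x" for w v x
  proof -
    have W: "v \<in> W" "x \<in> W" and "R w x" using that R_W R_trans by blast+
    then have "(B \<rightarrow>\<^sub>i C)\<^sup>t \<in> x" "B\<^sup>t \<in> x"
      using that W truth_goedel_imp by blast+
    then show ?thesis
      using truth_goedel_imp[OF W(2)] R_refl[OF W(2)] by blast
  qed
  then show ?case
    unfolding goedel_imp_provable by (meson truth_goedel_imp R_W)
next
  case (5 A B)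
  then show ?case
    unfolding goedel_imp_provable
    using truth_goedel_imp goedel_persistent R_W by (auto simp del: goedel.simps(5))
next
  case (8 A C B)
  have "C\<^sup>t \<in> x"
    if "w \<in> W" "R w v" "R v x" "(A \<rightarrow>\<^sub>i C)\<^sup>t \<in> w" "(B \<rightarrow>\<^sub>i C)\<^sup>t \<in> v" "(A \<or>\<^sub>i B)\<^sup>t \<in> x" for w v x
  proof -
    have W: "v \<in> W" "x \<in> W" and "R w x" using that R_W R_trans by blast+
    moreover have "A\<^sup>t \<in> x \<or> B\<^sup>t \<in> x" using that(6) W by simp
    ultimately show ?thesis
      using that truth_goedel_imp by blast
  qed
  then show ?case
    unfolding goedel_imp_provable by (meson truth_goedel_imp R_W)
qed (auto simp: goedel_imp_provable simp del: goedel.simps(5))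

text \<open>With the clauses for \<open>\<forall>\<close> and \<open>\<exists>\<close>, most of the axioms become first-order consequences of
  the reflexivity of \<open>R\<close> and of \<open>E\<close> being an equivalence relation. The
  exceptions use how the two relations interact:
  \<open>\<forall>p \<rightarrow> \<forall>\<forall>p\<close> and \<open>\<exists>\<forall>p \<leftrightarrow> \<forall>p\<close> need the invariance of \<open>\<box>\<forall>A\<close> under \<open>E\<close>, and \<open>\<exists>p \<leftrightarrow> \<forall>\<exists>p\<close> needs
  persistence.\<close>

lemma goedel_MIPC_axioms:
  assumes "A \<in> MIPC_axioms"
  shows "A\<^sup>t \<in> M"
proof -
  have and_all: "(\<forall>\<^sub>i (p \<and>\<^sub>i q) \<leftrightarrow>\<^sub>i (\<forall>\<^sub>i p \<and>\<^sub>i \<forall>\<^sub>i q))\<^sup>t \<in> M" for p q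
    unfolding goedel_iff_provable
    using truth_goedel_all R_W E_W by (auto simp del: goedel.simps(6))
  have all_elim: "(\<forall>\<^sub>i p \<rightarrow>\<^sub>i p)\<^sup>t \<in> M" for p
    unfolding goedel_imp_provable using box_all_elim by simp
  have all_all: "(\<forall>\<^sub>i p \<rightarrow>\<^sub>i \<forall>\<^sub>i (\<forall>\<^sub>i p))\<^sup>t \<in> M" for p
    unfolding goedel_imp_provable using box_all_box box_all_all by simp
  have or_ex: "(\<exists>\<^sub>i (p \<or>\<^sub>i q) \<leftrightarrow>\<^sub>i (\<exists>\<^sub>i p \<or>\<^sub>i \<exists>\<^sub>i q))\<^sup>t \<in> M" for p q
    unfolding goedel_iff_provable
    using truth_goedel_ex E_W by (auto simp del: goedel.simps(7))
  have ex_intro: "(p \<rightarrow>\<^sub>i \<exists>\<^sub>i p)\<^sup>t \<in> M" for p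
    unfolding goedel_imp_provable using truth_goedel_ex E_refl by blast
  have ex_ex: "(\<exists>\<^sub>i (\<exists>\<^sub>i p) \<rightarrow>\<^sub>i \<exists>\<^sub>i p)\<^sup>t \<in> M" for p
    unfolding goedel_imp_provable using truth_goedel_ex E_trans E_W by meson
  have ex_and: "((\<exists>\<^sub>i p \<and>\<^sub>i \<exists>\<^sub>i q) \<rightarrow>\<^sub>i \<exists>\<^sub>i (\<exists>\<^sub>i p \<and>\<^sub>i q))\<^sup>t \<in> M" for p q
  proof -
    have "(\<exists>\<^sub>i (\<exists>\<^sub>i p \<and>\<^sub>i q))\<^sup>t \<in> w" if "w \<in> W" "E w u" "p\<^sup>t \<in> u" "E w v" "q\<^sup>t \<in> v" for w u v
    proof -
      have "v \<in> W" "E v u" using that E_sym E_trans E_W by blast+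
      then have "(\<exists>\<^sub>i p \<and>\<^sub>i q)\<^sup>t \<in> v"
        using that truth_goedel_ex[of v p] by (auto simp del: goedel.simps(7))
      then show ?thesis using that truth_goedel_ex by blast
    qed
    then show ?thesis
      unfolding goedel_imp_provable using truth_goedel_ex by (auto simp del: goedel.simps(7))
  qed
  have ex_all: "(\<exists>\<^sub>i (\<forall>\<^sub>i p) \<leftrightarrow>\<^sub>i \<forall>\<^sub>i p)\<^sup>t \<in> M" for p
    unfolding goedel_iff_provable
    using truth_goedel_ex[of _ "\<forall>\<^sub>i p"] box_all_invariant E_sym E_refl E_W
    by (metis goedel.simps(6))
  have all_ex: "(\<exists>\<^sub>i p \<leftrightarrow>\<^sub>i \<forall>\<^sub>i (\<exists>\<^sub>i p))\<^sup>t \<in> M" for p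
  proof -
    have "(\<exists>\<^sub>i p)\<^sup>t \<in> u" if "w \<in> W" "(\<exists>\<^sub>i p)\<^sup>t \<in> w" "R w v" "E v u" for w v u
    proof -
      have "(\<exists>\<^sub>i p)\<^sup>t \<in> v" using that goedel_persistent by blast
      then show ?thesis
        using that truth_goedel_ex E_sym E_trans R_W E_W by meson
    qed
    then show ?thesis
      unfolding goedel_iff_provable
      using truth_goedel_all[of _ "\<exists>\<^sub>i p"] R_refl E_refl by blast
  qed
  show ?thesis
    using assms and_all all_elim all_all or_ex ex_intro ex_ex ex_and ex_all all_ex
    unfolding MIPC_axioms_def Let_def by blast
qed

text \<open>The translation commutes with substitution up to provable equivalence: at a letter the two
  sides are \<open>(s n)\<^sup>t\<close> and \<open>\<box>(s n)\<^sup>t\<close>, which agree by persistence.\<close>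

lemma goedel_isubst:
  "w \<in> W \<Longrightarrow> (isubst s A)\<^sup>t \<in> w \<longleftrightarrow> csubst (\<lambda>n. (s n)\<^sup>t) (A\<^sup>t) \<in> w"
proof (induction A arbitrary: w)
  case (ILet n)
  then show ?case using goedel_persistent R_refl truth_box by auto
next
  case (IImp A B)
  have "\<box>\<^sub>c C \<in> w \<longleftrightarrow> \<box>\<^sub>c D \<in> w" if "\<And>v. v \<in> W \<Longrightarrow> C \<in> v \<longleftrightarrow> D \<in> v" for C D
    using that truth_box IImp.prems R_W by blast
  then show ?case using IImp.IH by simp
next
  case (IAll A)
  then show ?case using truth_goedel_all[of w "isubst s A"] truth_box truth_all R_W E_W by auto
next
  case (IEx A)
  then show ?case using truth_ex E_W by auto
qed auto

lemma iextension_goedel_preimage: "iextension {A. A\<^sup>t \<in> M}"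
proof -
  have "(isubst s A)\<^sup>t \<in> M" if "A\<^sup>t \<in> M" for A s
    using subst[OF that, of "\<lambda>n. (s n)\<^sup>t"] by (simp add: provable_iff goedel_isubst)
  moreover have "(\<forall>\<^sub>i A)\<^sup>t \<in> M" if "A\<^sup>t \<in> M" for A
    using nec_box[OF nec_all[OF that]] by simp
  ultimately have "iclosed {A. A\<^sup>t \<in> M}"
    unfolding iclosed_def using goedel_mp by simp
  moreover from this have "MIPC \<subseteq> {A. A\<^sup>t \<in> M}"
    unfolding MIPC_def using goedel_IPC goedel_MIPC_axioms by (intro Inter_lower) auto
  ultimately show ?thesis
    unfolding iextension_def by simp
qed

text \<open>The disjunctions \<open>\<box>\<forall>A \<or> \<box>\<forall>B\<close> express that \<open>A\<close> or \<open>B\<close> holds globally, so for a fixed \<open>B\<close>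
  the formulas \<open>A\<close> for which they are provable are closed under modus ponens and both
  necessitations. Quantifying over the substitution instances of \<open>A\<close> makes them closed under
  substitution too.\<close>

lemma extend_global_disjunction:
  assumes base: "N \<subseteq> M"
    and gen: "\<And>A s. A \<in> \<Gamma> \<Longrightarrow> \<box>\<^sub>c (\<forall>\<^sub>c (csubst s A)) \<or>\<^sub>c \<box>\<^sub>c (\<forall>\<^sub>c B) \<in> M"
    and A: "A \<in> N \<oplus>\<^sub>c \<Gamma>"
  shows "\<box>\<^sub>c (\<forall>\<^sub>c A) \<or>\<^sub>c \<box>\<^sub>c (\<forall>\<^sub>c B) \<in> M"
proof -
  define K where "K = {A. \<forall>s. \<box>\<^sub>c (\<forall>\<^sub>c (csubst s A)) \<or>\<^sub>c \<box>\<^sub>c (\<forall>\<^sub>c B) \<in> M}"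
  have glob: "A \<in> K \<longleftrightarrow> (\<forall>s. \<forall>w\<in>W. \<box>\<^sub>c (\<forall>\<^sub>c (csubst s A)) \<in> w \<or> \<box>\<^sub>c (\<forall>\<^sub>c B) \<in> w)" for A
    unfolding K_def provable_iff by simp
  have M_K: "M \<subseteq> K"
  proof
    fix A assume "A \<in> M"
    then have "\<box>\<^sub>c (\<forall>\<^sub>c (csubst s A)) \<in> M" for s
      by (intro nec_box nec_all subst)
    then show "A \<in> K" unfolding glob by (simp add: provable_iff)
  qed
  have "C \<in> K" if "A \<in> K" "A \<rightarrow>\<^sub>c C \<in> K" for A C
    using that box_all_mp unfolding glob csubst.simps by metis
  moreover have "csubst s A \<in> K" if "A \<in> K" for A s
    using that unfolding K_def by (simp add: csubst_comp)
  moreover have "\<box>\<^sub>c A \<in> K" "\<forall>\<^sub>c A \<in> K" if "A \<in> K" for A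
    using that box_all_box box_all_all unfolding glob csubst.simps by metis+
  ultimately have "cclosed K" unfolding cclosed_def by blast
  then have "cextension K"
    using M_K extension unfolding cextension_def by blast
  moreover have "\<Gamma> \<subseteq> K"
    unfolding K_def using gen by blast
  then have "N \<union> \<Gamma> \<subseteq> K"
    using base M_K by blast
  ultimately have "A \<in> K" using A unfolding extend_def by blast
  then have "\<box>\<^sub>c (\<forall>\<^sub>c (csubst CLet A)) \<or>\<^sub>c \<box>\<^sub>c (\<forall>\<^sub>c B) \<in> M"
    unfolding K_def by blast
  then show ?thesis by (simp add: csubst_letters)
qed

end

section \<open>Intersections of extensions by formulas\<close>

lemma cextension_extend: "cextension (N \<oplus>\<^sub>c \<Gamma>)"
  unfolding extend_def by (rule cextension_Inter) simp

lemma extend_upper: "N \<subseteq> N \<oplus>\<^sub>c \<Gamma>" "\<Gamma> \<subseteq> N \<oplus>\<^sub>c \<Gamma>"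
  unfolding extend_def by blast+

lemma extend_least: "cextension M \<Longrightarrow> N \<subseteq> M \<Longrightarrow> \<Gamma> \<subseteq> M \<Longrightarrow> N \<oplus>\<^sub>c \<Gamma> \<subseteq> M"
  unfolding extend_def by blast

text \<open>The passage from generators to consequences is made first in the left disjunct, with a
  generator still on the right, and then in the right disjunct, with the consequence \<open>C\<close> already on
  the left.\<close>

lemma extend_Int_subset:
  assumes M: "cextension M" and N: "N \<subseteq> M"
    and gen: "\<And>A B s r. A \<in> \<Gamma> \<Longrightarrow> B \<in> \<Delta> \<Longrightarrow>
      \<box>\<^sub>c (\<forall>\<^sub>c (csubst s A)) \<or>\<^sub>c \<box>\<^sub>c (\<forall>\<^sub>c (csubst r B)) \<in> M"
  shows "(N \<oplus>\<^sub>c \<Gamma>) \<inter> (N \<oplus>\<^sub>c \<Delta>) \<subseteq> M"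
proof
  fix C assume C: "C \<in> (N \<oplus>\<^sub>c \<Gamma>) \<inter> (N \<oplus>\<^sub>c \<Delta>)"
  interpret ms4_extension M by unfold_locales (rule M)
  have comm: "A \<or>\<^sub>c B \<in> M \<Longrightarrow> B \<or>\<^sub>c A \<in> M" for A B
    unfolding provable_iff by auto
  have "\<box>\<^sub>c (\<forall>\<^sub>c C) \<or>\<^sub>c \<box>\<^sub>c (\<forall>\<^sub>c (csubst r B)) \<in> M" if "B \<in> \<Delta>" for B r
    using extend_global_disjunction[OF N, of \<Gamma>] gen that C by blast
  then have "\<box>\<^sub>c (\<forall>\<^sub>c C) \<or>\<^sub>c \<box>\<^sub>c (\<forall>\<^sub>c C) \<in> M"
    using extend_global_disjunction[OF N, of \<Delta>] comm C by blast
  then show "C \<in> M"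
    unfolding provable_iff using box_all_elim by simp
qed


section \<open>The lattice homomorphisms\<close>

abbreviation goedel_extend :: "cfm set \<Rightarrow> ifm set \<Rightarrow> cfm set" where
  "goedel_extend N L \<equiv> N \<oplus>\<^sub>c {A\<^sup>t | A. A \<in> L}"

lemma goedel_rename: "(isubst (\<lambda>n. ILet (f n)) A)\<^sup>t = csubst (\<lambda>n. CLet (f n)) (A\<^sup>t)"
  by (induction A) auto

lemma iextension_or_intro:
  assumes "iextension L"
  shows "A \<in> L \<Longrightarrow> A \<or>\<^sub>i B \<in> L" "B \<in> L \<Longrightarrow> A \<or>\<^sub>i B \<in> L"
proof -
  have "IPC \<subseteq> L" and mp: "\<And>A B. A \<in> L \<Longrightarrow> A \<rightarrow>\<^sub>i B \<in> L \<Longrightarrow> B \<in> L"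
    using assms unfolding iextension_def iclosed_def MIPC_def by blast+
  then show "A \<in> L \<Longrightarrow> A \<or>\<^sub>i B \<in> L" "B \<in> L \<Longrightarrow> A \<or>\<^sub>i B \<in> L"
    using IPC.intros(6,7) by blast+
qed

text \<open>Renaming the letters of \<open>A\<close> to even and those of \<open>B\<close> to odd ones makes the two substitutions
  \<open>s\<close> and \<open>r\<close> act independently. The disjunction \<open>\<forall>A \<or> \<forall>B\<close> of the renamed formulas belongs to both
  logics, and its translation is literally \<open>\<box>\<forall>A\<^sup>t \<or> \<box>\<forall>B\<^sup>t\<close>.\<close>

lemma goedel_global_disjunction:
  assumes L: "iextension L" "iextension L'" and AB: "A \<in> L" "B \<in> L'"
    and M: "cextension M" "{C\<^sup>t | C. C \<in> L \<inter> L'} \<subseteq> M"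
  shows "\<box>\<^sub>c (\<forall>\<^sub>c (csubst s (A\<^sup>t))) \<or>\<^sub>c \<box>\<^sub>c (\<forall>\<^sub>c (csubst r (B\<^sup>t))) \<in> M"
proof -
  let ?A = "isubst (\<lambda>n. ILet (2 * n)) A" and ?B = "isubst (\<lambda>n. ILet (2 * n + 1)) B"
  let ?u = "\<lambda>n. if even n then s (n div 2) else r (n div 2)"
  have "\<forall>\<^sub>i ?A \<in> L" "\<forall>\<^sub>i ?B \<in> L'"
    using L AB unfolding iextension_def iclosed_def by blast+
  then have "\<forall>\<^sub>i ?A \<or>\<^sub>i \<forall>\<^sub>i ?B \<in> L \<inter> L'"
    using iextension_or_intro L by blast
  then have "(\<forall>\<^sub>i ?A \<or>\<^sub>i \<forall>\<^sub>i ?B)\<^sup>t \<in> M" using M(2) by blast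
  then have "csubst ?u ((\<forall>\<^sub>i ?A \<or>\<^sub>i \<forall>\<^sub>i ?B)\<^sup>t) \<in> M"
    using M(1) unfolding cextension_def cclosed_def by blast
  then show ?thesis
    by (simp only: goedel.simps csubst.simps goedel_rename csubst_comp) simp
qed

lemma goedel_extend_mono: "L \<subseteq> L' \<Longrightarrow> goedel_extend N L \<subseteq> goedel_extend N L'"
  unfolding extend_def by blast

lemma goedel_extend_Int:
  assumes "iextension L" "iextension L'"
  shows "goedel_extend N (L \<inter> L') = goedel_extend N L \<inter> goedel_extend N L'"
proof
  show "goedel_extend N (L \<inter> L') \<subseteq> goedel_extend N L \<inter> goedel_extend N L'"
    by (intro Int_greatest goedel_extend_mono) auto
  show "goedel_extend N L \<inter> goedel_extend N L' \<subseteq> goedel_extend N (L \<inter> L')"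
  proof (rule extend_Int_subset)
    fix A B s r
    assume "A \<in> {A\<^sup>t | A. A \<in> L}" "B \<in> {A\<^sup>t | A. A \<in> L'}"
    then show "\<box>\<^sub>c (\<forall>\<^sub>c (csubst s A)) \<or>\<^sub>c \<box>\<^sub>c (\<forall>\<^sub>c (csubst r B)) \<in> goedel_extend N (L \<inter> L')"
      using goedel_global_disjunction[OF assms _ _ cextension_extend extend_upper(2)] by blast
  qed (rule cextension_extend extend_upper)+
qed

text \<open>By soundness, the formulas whose translation lies in \<open>M\<close> are an extension of MIPC, and so
  sending \<open>L\<close> to \<open>goedel_extend N L\<close> is a left adjoint.\<close>

lemma goedel_extend_adjoint:
  assumes "cextension M" "N \<subseteq> M"
  shows "goedel_extend N L \<subseteq> M \<longleftrightarrow> L \<subseteq> {A. A\<^sup>t \<in> M}"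
proof -
  have "goedel_extend N L \<subseteq> M \<longleftrightarrow> {A\<^sup>t | A. A \<in> L} \<subseteq> M"
    using extend_upper(2) extend_least[OF assms] by (meson order_trans)
  then show ?thesis by blast
qed

lemma goedel_extend_join:
  fixes L L' N
  defines "J \<equiv> \<Inter>{K. iextension K \<and> L \<union> L' \<subseteq> K}"
  shows "goedel_extend N J =
    \<Inter>{M. (cextension M \<and> N \<subseteq> M) \<and> goedel_extend N L \<union> goedel_extend N L' \<subseteq> M}"
proof
  show "goedel_extend N J \<subseteq>
    \<Inter>{M. (cextension M \<and> N \<subseteq> M) \<and> goedel_extend N L \<union> goedel_extend N L' \<subseteq> M}"
  proof (rule Inter_greatest)
    fix M assume "M \<in> {M. (cextension M \<and> N \<subseteq> M) \<and> goedel_extend N L \<union> goedel_extend N L' \<subseteq> M}"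
    then have M: "cextension M" "N \<subseteq> M" and "L \<union> L' \<subseteq> {A. A\<^sup>t \<in> M}"
      using goedel_extend_adjoint by auto
    then have "J \<subseteq> {A. A\<^sup>t \<in> M}"
      unfolding J_def using ms4_extension.iextension_goedel_preimage[OF ms4_extension.intro, OF M(1)]
      by blast
    then show "goedel_extend N J \<subseteq> M"
      using goedel_extend_adjoint[OF M] by blast
  qed
  have "L \<subseteq> J" "L' \<subseteq> J"
    unfolding J_def by blast+
  then have "goedel_extend N L \<union> goedel_extend N L' \<subseteq> goedel_extend N J"
    by (intro Un_least goedel_extend_mono)
  then show "\<Inter>{M. (cextension M \<and> N \<subseteq> M) \<and> goedel_extend N L \<union> goedel_extend N L' \<subseteq> M} \<subseteq>
      goedel_extend N J"
    using cextension_extend extend_upper(1) by (intro Inter_lower) simp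
qed

lemma lattice_hom_goedel_extend:
  fixes N
  defines "Y \<equiv> \<lparr>carrier = {M. cextension M \<and> N \<subseteq> M}, eq = (=), le = (\<subseteq>)\<rparr>"
  shows "lattice_hom \<Lambda>MIPC Y (goedel_extend N)"
proof -
  have inter: "cextension (\<Inter>\<A>) \<and> N \<subseteq> \<Inter>\<A>"
    if "\<And>L. L \<in> \<A> \<Longrightarrow> cextension L \<and> N \<subseteq> L" for \<A>
    using that cextension_Inter[of \<A>] by blast
  note Y = closure_order[where P = "\<lambda>M. cextension M \<and> N \<subseteq> M", OF inter, folded Y_def]
  have mem: "cextension (goedel_extend N L) \<and> N \<subseteq> goedel_extend N L" for L
    using cextension_extend extend_upper(1) by blast
  interpret X: complete_lattice \<Lambda>MIPC by (rule Lambda_MIPC_lattice(1))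
  interpret Y: complete_lattice Y by (rule Y(1))
  have carrier: "carrier \<Lambda>MIPC = {L. iextension L}" "carrier Y = {M. cextension M \<and> N \<subseteq> M}"
    by (simp_all add: Lambda_MIPC_def Y_def)
  show ?thesis
    unfolding lattice_hom_def join_pres_def meet_pres_def carrier
    using mem X.lattice_axioms Y.lattice_axioms
    by (auto simp only: Lambda_MIPC_lattice(2,3) Y(2,3)[OF _ mem mem] goedel_extend_Int
        goedel_extend_join mem_Collect_eq simp_thms intro!: funcsetI)
qed

theorem theorem6p3:
  shows "lattice_hom \<Lambda>MIPC \<Lambda>MS4 \<tau> \<and> lattice_hom \<Lambda>MIPC \<Lambda>MGrz \<sigma>"
proof -
  have "\<tau> = goedel_extend MS4" "\<sigma> = goedel_extend MGrz"
    by (simp_all add: fun_eq_iff tau_def sigma_def)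
  moreover have "\<Lambda>MS4 = \<lparr>carrier = {M. cextension M \<and> MS4 \<subseteq> M}, eq = (=), le = (\<subseteq>)\<rparr>"
    unfolding Lambda_MS4_def cextension_def by simp metis
  ultimately show ?thesis
    using lattice_hom_goedel_extend[of MS4] lattice_hom_goedel_extend[of MGrz]
    by (simp add: Lambda_MGrz_def)
qed

end
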